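(* Let $G$ be a finite group of order $n > 1$ and let $f : G \to S$ be an oracle hiding a subgroup $H$ of order $m$. Suppose $G$ has a subgroup $G_0$ of order $n/m$ with $|G_0 \cap H| = 1$. Then Algorithm Find-Subgroup$(G, f)$ (described in the context) outputs "injective" if $H$ is trivial, and otherwise outputs a set $S$ of elements generating $H$. Moreover, the algorithm makes $O\big((1 + \log m)\sqrt{n/m}\big)$ queries when $G$ is abelian, and $O\big((1 + \log m)\sqrt{(n/m)\log(n/m)}\big)$ queries when $G$ is non-abelian.
   Context: Hidden Subgroup Problem: $G$ a finite group given explicitly; $f : G \to S$ with $|S| \ge |G|$ is accessed by queries and hides a subgroup $H \le G$, meaning $f(x) = f(y)$ iff $x^{-1}y \in H$. $e$ is the identity of $G$; $\langle S\rangle$ is the subgroup generated by $S$. A generating pair for a group $G_1$ is a pair $S_1, S_2 \subseteq G_1$ with $S_1 S_2 := \{xy : x \in S_1, y \in S_2\} = G_1$; $S_1^{-1} := \{x^{-1} : x \in S_1\}$; $G_1 H_1 := \{xy : x \in G_1, y \in H_1\}$. Subroutine Find-New-Collision$(G, H_1, f)$ for a subgroup $H_1 \le G$: let $k$ be the integer $l$ with $n \in (2^l, 2^{l+1}]$; set $m_1' := \max\{2, |H_1|\}$ if $G$ is abelian and $m_1' := |H_1|$ otherwise; $k_0 := \lceil \log_2 m_1'\rceil - 1$. While $k \ge k_0$: find, if one exists, a subgroup $G_1 \le G$ of largest order in $[n/2^{k+1}, \; n/(\lfloor 2^k\rfloor+1)]$ with $G_1 \cap H_1 = \{e\}$; if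 it exists, find a generating pair $S_1, S_2$ for $G_1$ minimizing $\max\{|S_1|,|S_2|\}$, let $g := e$ if $G_1 H_1 = G$ and otherwise any element of $G \setminus G_1 H_1$, let $R := S_1^{-1} \cup S_2 \cup S_1^{-1}\{g\}$, query $f$ on all of $R$, and if $f(z) = f(y)$ for some $z, y \in R$ with $z^{-1}y \notin H_1$, return "collision $z, y$". Then decrease $k$ by $1$. If the loop ends, return "no-new-collision". Algorithm Find-Subgroup$(G, f)$: set $S := \emptyset$; repeat: $H_1 := \langle S\rangle$, run Find-New-Collision$(G, H_1, f)$, and if it returns "collision $a, b$", set $S := S \cup \{a^{-1}b\}$; stop when it returns "no-new-collision". Return "injective" if $S = \emptyset$, and otherwise return $S$. (Choices are made by any fixed deterministic rule.) A bound $O(E)$ means at most $C \cdot \max\{1, E\}$ queries for an absolute constant $C$ independent of $G, f, H$.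
   Formalization: In the non-abelian bound log(n/m) is read as max(1, log(n/m)), which matters only for H = G, where the literal constant bound is false; the absolute constant is stated for groups on one carrier type, which covers all finite groups up to isomorphism. *)

theory Defs
  imports "HOL-Algebra.Algebra" "HOL-Library.Equipollence"
begin

definition hides :: "('a, 'b) monoid_scheme \<Rightarrow> ('a \<Rightarrow> 's) \<Rightarrow> 'a set \<Rightarrow> bool" where
  "hides G f H \<longleftrightarrow> (\<forall>x\<in>carrier G. \<forall>y\<in>carrier G. f x = f y \<longleftrightarrow> inv\<^bsub>G\<^esub> x \<otimes>\<^bsub>G\<^esub> y \<in> H)"

definition generating_pair :: "('a, 'b) monoid_scheme \<Rightarrow> 'a set \<Rightarrow> 'a set \<times> 'a set \<Rightarrow> bool" where
  "generating_pair G G1 = (\<lambda>(S1, S2). S1 \<subseteq> G1 \<and> S2 \<subseteq> G1 \<and> S1 <#>\<^bsub>G\<^esub> S2 = G1)"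

definition admissible :: "('a, 'b) monoid_scheme \<Rightarrow> 'a set \<Rightarrow> int \<Rightarrow> 'a set \<Rightarrow> bool" where
  "admissible G H1 k G1 \<longleftrightarrow>
     subgroup G1 G \<and>
     real (card G1) \<in> {real (order G) / 2 powi (k + 1) ..
                       real (order G) / (of_int \<lfloor>(2::real) powi k\<rfloor> + 1)} \<and>
     G1 \<inter> H1 = {\<one>\<^bsub>G\<^esub>}"

definition new_collision ::
    "('a, 'b) monoid_scheme \<Rightarrow> 'a set \<Rightarrow> 'a set \<Rightarrow> ('a \<Rightarrow> 's) \<Rightarrow> 'a \<times> 'a \<Rightarrow> bool" where
  "new_collision G H1 R t =
     (\<lambda>(z, y). z \<in> R \<and> y \<in> R \<and> t z = t y \<and> inv\<^bsub>G\<^esub> z \<otimes>\<^bsub>G\<^esub> y \<notin> H1)"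

text \<open>
  A deterministic rule for the choices that the algorithm leaves open. Each component may depend
  on the data available when the choice is made: the subgroup \<open>H1\<close>, the index \<open>k\<close>, and the objects
  already chosen in the same pass. The oracle is visible to the rule only through the table of the
  answers obtained in that pass.
\<close>

record ('a, 's) choices =
  pick_subgroup :: "'a set \<Rightarrow> int \<Rightarrow> 'a set"
  pick_pair :: "'a set \<Rightarrow> int \<Rightarrow> 'a set \<Rightarrow> 'a set \<times> 'a set"
  pick_outside :: "'a set \<Rightarrow> int \<Rightarrow> 'a set \<Rightarrow> 'a set \<times> 'a set \<Rightarrow> 'a"
  pick_collision :: "'a set \<Rightarrow> int \<Rightarrow> 'a set \<Rightarrow> ('a \<Rightarrow> 's) \<Rightarrow> 'a \<times> 'a"

definition valid_choices :: "('a, 'b) monoid_scheme \<Rightarrow> ('a, 's) choices \<Rightarrow> bool" where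
  "valid_choices G c \<longleftrightarrow>
     (\<forall>H1 k. subgroup H1 G \<longrightarrow> (\<exists>G1. admissible G H1 k G1) \<longrightarrow>
        is_arg_max card (admissible G H1 k) (pick_subgroup c H1 k)) \<and>
     (\<forall>H1 k G1. subgroup H1 G \<longrightarrow> subgroup G1 G \<longrightarrow>
        is_arg_min (\<lambda>(S1, S2). max (card S1) (card S2)) (generating_pair G G1)
          (pick_pair c H1 k G1)) \<and>
     (\<forall>H1 k G1 P. subgroup H1 G \<longrightarrow> subgroup G1 G \<longrightarrow> G1 <#>\<^bsub>G\<^esub> H1 \<noteq> carrier G \<longrightarrow>
        pick_outside c H1 k G1 P \<in> carrier G - (G1 <#>\<^bsub>G\<^esub> H1)) \<and>
     (\<forall>H1 k R t. (\<exists>p. new_collision G H1 R t p) \<longrightarrow>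
        new_collision G H1 R t (pick_collision c H1 k R t))"

datatype 'a search_result = Collision 'a 'a | No_New_Collision

datatype 'a answer = Injective | Generators "'a set"

text \<open>
  One pass of the loop of Find-New-Collision. All procedures return, besides their result, the
  number of oracle queries made; querying \<open>f\<close> on all of \<open>R\<close> costs \<open>card R\<close> queries and
  yields the table \<open>restrict f R\<close>.
\<close>

definition search_pass ::
    "('a, 'b) monoid_scheme \<Rightarrow> ('a, 's) choices \<Rightarrow> 'a set \<Rightarrow> ('a \<Rightarrow> 's) \<Rightarrow> int
       \<Rightarrow> 'a search_result \<times> nat" where
  "search_pass G c H1 f k =
     (if \<exists>G1. admissible G H1 k G1 then
        let G1 = pick_subgroup c H1 k;
            (S1, S2) = pick_pair c H1 k G1;
            g = (if G1 <#>\<^bsub>G\<^esub> H1 = carrier G then \<one>\<^bsub>G\<^esub> else pick_outside c H1 k G1 (S1, S2));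
            R = set_inv\<^bsub>G\<^esub> S1 \<union> S2 \<union> (set_inv\<^bsub>G\<^esub> S1 <#>\<^bsub>G\<^esub> {g});
            t = restrict f R
        in (if \<exists>p. new_collision G H1 R t p
            then let (z, y) = pick_collision c H1 k R t in (Collision z y, card R)
            else (No_New_Collision, card R))
      else (No_New_Collision, 0))"

function search_loop ::
    "('a, 'b) monoid_scheme \<Rightarrow> ('a, 's) choices \<Rightarrow> 'a set \<Rightarrow> ('a \<Rightarrow> 's) \<Rightarrow> int \<Rightarrow> int
       \<Rightarrow> 'a search_result \<times> nat" where
  "search_loop G c H1 f k0 k =
     (if k0 \<le> k then
        (case search_pass G c H1 f k of
           (Collision z y, q) \<Rightarrow> (Collision z y, q)
         | (No_New_Collision, q) \<Rightarrow>
             (let (r, q') = search_loop G c H1 f k0 (k - 1) in (r, q + q')))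
      else (No_New_Collision, 0))"
  by pat_completeness auto
termination
  by (relation "measure (\<lambda>(G, c, H1, f, k0, k). nat (k - k0 + 1))") auto

declare search_loop.simps [simp del]

definition initial_index :: "nat \<Rightarrow> int" where
  "initial_index n = (THE l. real n \<in> {2 powi l <.. 2 powi (l + 1)})"

definition final_index :: "('a, 'b) monoid_scheme \<Rightarrow> 'a set \<Rightarrow> int" where
  "final_index G H1 =
     \<lceil>log 2 (real (if comm_group G then max 2 (card H1) else card H1))\<rceil> - 1"

definition find_new_collision ::
    "('a, 'b) monoid_scheme \<Rightarrow> ('a, 's) choices \<Rightarrow> 'a set \<Rightarrow> ('a \<Rightarrow> 's)
       \<Rightarrow> 'a search_result \<times> nat" where
  "find_new_collision G c H1 f =
     search_loop G c H1 f (final_index G H1) (initial_index (order G))"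

text \<open>
  The outer loop, with the current set \<open>S\<close> and the number \<open>q\<close> of queries made so far. The value
  \<open>None\<close> stands for non-termination.
\<close>

partial_function (option) find_subgroup_loop ::
    "('a, 'b) monoid_scheme \<Rightarrow> ('a, 's) choices \<Rightarrow> ('a \<Rightarrow> 's) \<Rightarrow> 'a set \<Rightarrow> nat
       \<Rightarrow> ('a answer \<times> nat) option" where
  "find_subgroup_loop G c f S q =
     (case find_new_collision G c (generate G S) f of
        (Collision a b, q') \<Rightarrow>
          find_subgroup_loop G c f (S \<union> {inv\<^bsub>G\<^esub> a \<otimes>\<^bsub>G\<^esub> b}) (q + q')
      | (No_New_Collision, q') \<Rightarrow>
          Some (if S = {} then Injective else Generators S, q + q'))"

definition find_subgroup ::
    "('a, 'b) monoid_scheme \<Rightarrow> ('a, 's) choices \<Rightarrow> ('a \<Rightarrow> 's) \<Rightarrow> ('a answer \<times> nat) option" where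
  "find_subgroup G c f = find_subgroup_loop G c f {} 0"

text \<open>
  The logarithm in the non-abelian query bound. It is applied to an index \<open>x = n / m\<close>, a positive
  integer, so it differs from \<open>log 2 x\<close> only at \<open>x = 1\<close>, that is for \<open>H = G\<close>. There a factor
  \<open>log 2 1 = 0\<close> would leave a constant bound, which cannot hold: the algorithm then has to find a
  generating set of \<open>G\<close>, and the number of generators needed is unbounded.
\<close>

definition index_log :: "real \<Rightarrow> real" where
  "index_log x = max 1 (log 2 x)"

lemma index_log_eq: "x \<ge> 2 \<Longrightarrow> index_log x = log 2 x"
  by (simp add: index_log_def max_def)

lemma ex_initial_index:
  assumes "n > 0"
  shows "real n \<in> {2 powi initial_index n <.. 2 powi (initial_index n + 1)}"
proof -
  have eq: "real n \<in> {2 powi l <.. 2 powi (l + 1)} \<longleftrightarrow> l = \<lceil>log 2 (real n)\<rceil> - 1" for l :: int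
  proof -
    have "(2::real) powi l < real n \<longleftrightarrow> of_int l < log 2 (real n)"
      using assms by (simp add: less_log_iff powr_real_of_int')
    moreover have "real n \<le> 2 powi (l + 1) \<longleftrightarrow> log 2 (real n) \<le> of_int (l + 1)"
      using assms by (simp add: log_le_iff powr_real_of_int' flip: of_int_add)
    ultimately show ?thesis by (auto; linarith)
  qed
  show ?thesis unfolding initial_index_def by (rule theI') (simp only: eq, blast)
qed

lemma (in group) ex_valid_choices:
  assumes "finite (carrier G)"
  shows "\<exists>c :: ('a, 's) choices. valid_choices G c"
proof -
  have "\<exists>K. is_arg_max card (admissible G H1 k) K" if ex: "\<exists>G1. admissible G H1 k G1" for H1 k
  proof -
    obtain G1 where G1: "admissible G H1 k G1"
      using ex by blast
    have "card K < Suc (card (carrier G))" if "admissible G H1 k K" for K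
      using that by (simp add: admissible_def less_Suc_eq_le card_mono assms subgroup.subset)
    then have "\<exists>K. admissible G H1 k K \<and> (\<forall>K'. admissible G H1 k K' \<longrightarrow> card K' \<le> card K)"
      using Lattices_Big.ex_has_greatest_nat[of "admissible G H1 k" G1 card] G1 by blast
    then show ?thesis
      by (simp only: is_arg_max_linorder)
  qed
  then obtain c1 where c1: "\<And>H1 k. \<exists>G1. admissible G H1 k G1 \<Longrightarrow>
      is_arg_max card (admissible G H1 k) (c1 H1 k)"
    by metis
  have "\<exists>P. is_arg_min (\<lambda>(S1, S2). max (card S1) (card S2)) (generating_pair G G1) P"
    if "subgroup G1 G" for G1
  proof -
    have "generating_pair G G1 (G1, G1)"
      using that by (simp add: generating_pair_def subgroup_mult_id)
    then show ?thesis
      using ex_has_least_nat[of "generating_pair G G1" "(G1, G1)"]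
      unfolding is_arg_min_linorder by blast
  qed
  then obtain c2 where c2: "\<And>G1. subgroup G1 G \<Longrightarrow>
      is_arg_min (\<lambda>(S1, S2). max (card S1) (card S2)) (generating_pair G G1) (c2 G1)"
    by metis
  define c3 where "c3 G1 H1 = (SOME x. x \<in> carrier G - (G1 <#> H1))" for G1 H1
  have c3: "c3 G1 H1 \<in> carrier G - (G1 <#> H1)"
    if "subgroup H1 G" "subgroup G1 G" "G1 <#> H1 \<noteq> carrier G" for G1 H1
  proof -
    have "\<exists>x. x \<in> carrier G - (G1 <#> H1)"
      using that setmult_subset_G[of G1 H1] by (blast dest: subgroup.subset)
    then show ?thesis
      unfolding c3_def by (rule someI_ex[where P = "\<lambda>x. x \<in> carrier G - (G1 <#> H1)"])
  qed
  define c :: "('a, 's) choices" where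
    "c = \<lparr>pick_subgroup = c1, pick_pair = (\<lambda>_ _. c2), pick_outside = (\<lambda>H1 _ G1 _. c3 G1 H1),
          pick_collision = (\<lambda>H1 _ R t. SOME p. new_collision G H1 R t p)\<rparr>"
  have "valid_choices G c"
    unfolding valid_choices_def c_def choices.simps
  proof (intro conjI allI impI, goal_cases)
    case 1 then show ?case using c1 by blast
  next
    case 2 then show ?case using c2 by blast
  next
    case 3 then show ?case using c3 by blast
  next
    case (4 H1 k R t)
    then show ?case by (rule someI_ex[of "new_collision G H1 R t"])
  qed
  then show ?thesis ..
qed

end

theory Submission
  imports Defs
begin

text \<open>
  Suppose the algorithm has found a proper subgroup \<open>H1\<close> of the hidden subgroup \<open>H\<close> of order \<open>m\<close>.
  At the index \<open>l\<close> with \<open>2\<^sup>l < m \<le> 2\<^sup>l\<^sup>+\<^sup>1\<close> the complement \<open>G0\<close> of \<open>H\<close> competes, so the chosen \<open>G1\<close> has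
  order at least \<open>n / m\<close>. If \<open>G1\<close> meets \<open>H\<close> nontrivially, writing a common element as a product
  \<open>x y\<close> from the generating pair gives the collision \<open>x\<inverse>, y\<close>; otherwise \<open>G1 H = G\<close>, and the
  decomposition of the shift \<open>g\<close> gives a collision with a point \<open>x\<inverse> g\<close>. So a search never goes
  below \<open>l\<close> (when \<open>H1 = H\<close>, by the choice of \<open>k\<^sub>0\<close>), its cost is a geometric sum
  dominated by the term for \<open>G1\<close> of order about \<open>n / m\<close>, and since each new collision at least doubles
  \<open>H1\<close>, there are at most \<open>1 + log m\<close> searches.

  Generating pairs of size \<open>O(\<surd>N)\<close> in an abelian group of order \<open>N\<close> come from a maximal subgroup
  among those of order at most \<open>\<surd>N\<close>, extended by one element; in an arbitrary group, pairs of size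
  \<open>O(\<surd>(N log N))\<close> come from covering the group greedily by translates of an arbitrary set.
\<close>

section \<open>Products of subsets and coset representatives in finite groups\<close>

lemma real_ceiling_le_double:
  assumes "1 \<le> x"
  shows "real (nat \<lceil>x\<rceil>) \<le> 2 * x"
  using assms by linarith

lemma (in group) nat_pow_in_subgroup:
  assumes "subgroup K G" "x \<in> K"
  shows "x [^] (i :: nat) \<in> K"
  by (induction i) (use assms in \<open>auto intro: subgroup.one_closed subgroup.m_closed\<close>)

lemma (in group) card_set_mult_le:
  assumes "finite A" "finite B"
  shows "finite (A <#> B)" "card (A <#> B) \<le> card A * card B"
proof -
  have eq: "A <#> B = (\<lambda>(a, b). a \<otimes> b) ` (A \<times> B)"
    by (auto simp: set_mult_def)
  show "finite (A <#> B)" "card (A <#> B) \<le> card A * card B"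
    using assms card_image_le[of "A \<times> B" "\<lambda>(a, b). a \<otimes> b"]
    by (simp_all add: eq card_cartesian_product)
qed

lemma (in group) card_set_mult_subgroups:
  assumes A: "subgroup A G" and B: "subgroup B G" and AB: "A \<inter> B = {\<one>}"
  shows "card (A <#> B) = card A * card B"
proof -
  have "inj_on (\<lambda>(a, b). a \<otimes> b) (A \<times> B)"
  proof (rule inj_onI, clarify)
    fix a b a' b'
    assume in_AB: "a \<in> A" "b \<in> B" "a' \<in> A" "b' \<in> B" and eq: "a \<otimes> b = a' \<otimes> b'"
    have c: "a \<in> carrier G" "b \<in> carrier G" "a' \<in> carrier G" "b' \<in> carrier G"
      using in_AB A B subgroup.mem_carrier by metis+
    have "inv a' \<otimes> a = b' \<otimes> inv b"
      using eq c by (metis inv_closed inv_solve_left inv_solve_right m_assoc m_closed)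
    moreover have "inv a' \<otimes> a \<in> A" "b' \<otimes> inv b \<in> B"
      using in_AB A B by (simp_all add: subgroup.m_closed subgroup.m_inv_closed)
    ultimately have "inv a' \<otimes> a = \<one>" "b' \<otimes> inv b = \<one>"
      using AB by auto
    then show "a = a' \<and> b = b'"
      using c by (metis inv_closed inv_equality inv_inv)
  qed
  moreover have "A <#> B = (\<lambda>(a, b). a \<otimes> b) ` (A \<times> B)"
    by (auto simp: set_mult_def)
  ultimately show ?thesis
    by (simp add: card_image card_cartesian_product)
qed

lemma (in group) exists_transversal:
  assumes fin: "finite (carrier G)" and K: "subgroup K G"
  obtains T where "T \<subseteq> carrier G" "card T * card K = order G" "K <#> T = carrier G"
proof -
  define r where "r C = (SOME g. g \<in> carrier G \<and> C = K #> g)" for C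
  have r: "r C \<in> carrier G \<and> C = K #> r C" if "C \<in> rcosets K" for C
    unfolding r_def by (rule someI_ex) (use that in \<open>auto simp: RCOSETS_def\<close>)
  have inj: "inj_on r (rcosets K)"
    by (rule inj_onI) (metis r)
  show thesis
  proof
    show T: "r ` (rcosets K) \<subseteq> carrier G"
      using r by auto
    show "card (r ` (rcosets K)) * card K = order G"
      using lagrange[OF K] by (simp add: card_image inj)
    have "g \<in> K <#> r ` (rcosets K)" if g: "g \<in> carrier G" for g
    proof -
      have C: "K #> g \<in> rcosets K"
        using g K by (simp add: rcosetsI subgroup.subset)
      have "g \<in> K #> r (K #> g)"
        using r[OF C] rcos_self[OF g K] by simp
      then show ?thesis
        using C by (auto simp: r_coset_def set_mult_def)
    qed
    then show "K <#> r ` (rcosets K) = carrier G"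
      using setmult_subset_G[OF subgroup.subset[OF K] T] by auto
  qed
qed

section \<open>Generating pairs in abelian groups\<close>

text \<open>Let \<open>K\<close> be a subgroup of largest order among those whose squared order is
  at most \<open>N\<close>, let \<open>x\<close> lie outside \<open>K\<close>, and let
  \<open>p\<close> be the order of \<open>x\<close> modulo \<open>K\<close>. The subgroup
  \<open>L\<close> generated by \<open>x\<close> and \<open>K\<close> has order
  \<open>p * card K\<close>, and its square exceeds \<open>N\<close>. With representatives
  \<open>T\<close> of the cosets of \<open>L\<close>, every element is a product of some
  \<open>t\<close>, a power of \<open>x\<close> below \<open>p\<close> and an element of
  \<open>K\<close>; sharing the power between the two factors brings both to size about
  \<open>sqrt N\<close>.\<close>

lemma (in comm_group) generating_pair_sqrt:
  assumes fin: "finite (carrier G)"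
  shows "\<exists>S1 S2. generating_pair G (carrier G) (S1, S2) \<and>
    max (card S1) (card S2) \<le> 2 * sqrt (order G)"
proof -
  define N where "N = order G"
  have N0: "N \<ge> 1"
    using fin N_def order_gt_0_iff_finite by (simp add: Suc_leI)
  define P where "P K \<longleftrightarrow> subgroup K G \<and> card K * card K \<le> N" for K
  have "P {\<one>}"
    using N0 by (simp add: P_def triv_subgroup)
  moreover have "card K < Suc N" if "P K" for K
    using that fin by (simp add: P_def N_def order_def card_mono subgroup.subset less_Suc_eq_le)
  ultimately obtain K where K: "P K" and K_max: "\<And>K'. P K' \<Longrightarrow> card K' \<le> card K"
    using Lattices_Big.ex_has_greatest_nat[of P "{\<one>}" card "Suc N"] by blast
  have subK: "subgroup K G" and cardK: "card K * card K \<le> N"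
    using K by (auto simp: P_def)
  have finK: "finite K"
    using subK fin finite_subset subgroup.subset by blast
  have K0: "card K \<ge> 1"
    using subgroup.finite_imp_card_positive[OF subK fin] by simp
  show ?thesis
  proof (cases "K = carrier G")
    case True
    \<comment> \<open>A whole group whose order satisfies the defining bound of \<open>P\<close> is
      trivial.\<close>
    then have "N * N \<le> N"
      using cardK by (simp add: N_def order_def)
    then have "N = 1"
      using N0 by (cases N) auto
    then have "generating_pair G (carrier G) (carrier G, carrier G)"
      by (simp add: generating_pair_def subgroup_mult_id subgroup_self)
    then show ?thesis
      using \<open>N = 1\<close> by (intro exI[of _ "carrier G"]) (simp add: N_def order_def)
  next
    case False
    then obtain x where x: "x \<in> carrier G" "x \<notin> K"
      using subgroup.subset[OF subK] by blast
    \<comment> \<open>Exponents of \<open>x\<close> can be reduced modulo \<open>p\<close> at the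
      cost of an element of \<open>K\<close>, and minimality of \<open>p\<close> makes the reduced
      form unique.\<close>
    define p where "p = (LEAST p::nat. p > 0 \<and> x [^] p \<in> K)"
    have "ord x > 0 \<and> x [^] ord x \<in> K"
      using ord_ge_1[OF fin x(1)] pow_ord_eq_1[OF x(1)] subgroup.one_closed[OF subK] by simp
    then have p: "p > 0" "x [^] p \<in> K"
      using LeastI[of "\<lambda>p::nat. p > 0 \<and> x [^] p \<in> K" "ord x"] by (auto simp: p_def)
    have p_min: "i = 0" if "x [^] i \<in> K" "i < p" for i :: nat
      using not_less_Least[of i "\<lambda>p::nat. p > 0 \<and> x [^] p \<in> K"] that by (auto simp: p_def)
    define L where "L = generate G {x} <#> K"
    have sub_gen: "subgroup (generate G {x}) G"
      using x by (simp add: generate_is_subgroup)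
    have subL: "subgroup L G"
      unfolding L_def using sub_gen subK by (rule mult_subgroups)
    have finL: "finite L"
      using subL fin finite_subset subgroup.subset by blast
    have KL: "k \<in> L" if "k \<in> K" for k
      using that subK generate.one[of G "{x}"] unfolding L_def set_mult_def
      by (force simp: subgroup.mem_carrier)
    have xL: "x \<in> L"
      using x subK generate.incl[of x "{x}" G] subgroup.one_closed[OF subK]
      unfolding L_def set_mult_def by force
    have L_pow: "\<exists>i<p. \<exists>k\<in>K. g = x [^] i \<otimes> k" if "g \<in> L" for g
    proof -
      obtain i :: nat and k where ik: "g = x [^] i \<otimes> k" "k \<in> K"
        using \<open>g \<in> L\<close> generate_pow_on_finite_carrier[OF fin x(1)]
        by (force simp: L_def set_mult_def)
      have kc: "k \<in> carrier G"
        using ik(2) subgroup.mem_carrier[OF subK] by simp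
      have "(x [^] p) [^] (i div p) = x [^] (p * (i div p))"
        using x by (simp add: nat_pow_pow)
      then have "x [^] (i mod p) \<otimes> (x [^] p) [^] (i div p) = x [^] i"
        using x by (simp add: nat_pow_mult)
      then have "g = x [^] (i mod p) \<otimes> ((x [^] p) [^] (i div p) \<otimes> k)"
        using ik x kc by (simp add: m_assoc[symmetric])
      moreover have "(x [^] p) [^] (i div p) \<otimes> k \<in> K"
        using subgroup.m_closed[OF subK nat_pow_in_subgroup[OF subK p(2)] ik(2)] .
      ultimately show ?thesis
        using p by (intro exI[of _ "i mod p"]) auto
    qed
    have cardL: "p * card K \<le> card L"
    proof -
      have "inj_on (\<lambda>(i, k). x [^] i \<otimes> k) ({..<p} \<times> K)"
      proof -
        \<comment> \<open>Cancelling the smaller power puts \<open>x [^] (j - i)\<close> into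
          \<open>K\<close>, which minimality of \<open>p\<close> permits only for
          \<open>i = j\<close>.\<close>
        have *: "i = j \<and> k = l" if "i \<le> j" "j < p" "k \<in> K" "l \<in> K"
          and eq: "x [^] i \<otimes> k = x [^] j \<otimes> l" for i j :: nat and k l
        proof -
          have c: "k \<in> carrier G" "l \<in> carrier G"
            using that(3,4) subgroup.mem_carrier[OF subK] by simp_all
          have "x [^] j = x [^] i \<otimes> x [^] (j - i)"
            using x \<open>i \<le> j\<close> by (simp add: nat_pow_mult)
          then have "x [^] i \<otimes> k = x [^] i \<otimes> (x [^] (j - i) \<otimes> l)"
            using eq x c by (simp add: m_assoc)
          then have k: "k = x [^] (j - i) \<otimes> l"
            using x c by simp
          then have "x [^] (j - i) = k \<otimes> inv l"
            using x c by (simp add: m_assoc)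
          then have "x [^] (j - i) \<in> K"
            using that subK by (simp add: subgroup.m_closed subgroup.m_inv_closed)
          then have "j - i = 0"
            using that by (intro p_min) auto
          then show ?thesis
            using \<open>i \<le> j\<close> k c by simp
        qed
        show ?thesis
        proof (rule inj_onI, clarify)
          fix i k j l
          assume a: "i < p" "k \<in> K" "j < p" "l \<in> K" "x [^] i \<otimes> k = x [^] j \<otimes> l"
          then show "i = j \<and> k = l"
            using *[of i j k l] *[of j i l k] by (cases "i \<le> j") auto
        qed
      qed
      moreover have "(\<lambda>(i, k). x [^] i \<otimes> k) ` ({..<p} \<times> K) \<subseteq> L"
        using KL subL xL
        by (auto intro!: subgroup.m_closed nat_pow_in_subgroup)
      ultimately show ?thesis
        using card_inj_on_le[of "\<lambda>(i, k). x [^] i \<otimes> k" "{..<p} \<times> K" L] finL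
        by (simp add: card_cartesian_product)
    qed
    have L_large: "N < card L * card L"
    proof (rule ccontr)
      assume "\<not> ?thesis"
      then have "card L \<le> card K"
        using subL by (intro K_max) (simp add: P_def)
      moreover have "K \<subset> L"
        using KL xL x by blast
      ultimately show False
        using psubset_card_mono[OF finL] by (meson not_less)
    qed
    have L_eq: "card L \<le> p * card K"
    proof -
      have "L \<subseteq> (\<lambda>(i, k). x [^] i \<otimes> k) ` ({..<p} \<times> K)"
      proof
        fix g assume "g \<in> L"
        then obtain i k where "i < p" "k \<in> K" "g = x [^] i \<otimes> k"
          using L_pow by blast
        then show "g \<in> (\<lambda>(i, k). x [^] i \<otimes> k) ` ({..<p} \<times> K)"
          by (intro image_eqI[of _ _ "(i, k)"]) auto
      qed
      then have "card L \<le> card ({..<p} \<times> K)"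
        using finK by (intro surj_card_le) auto
      then show ?thesis
        by (simp add: card_cartesian_product)
    qed
    define b where "b = real (card K)"
    define r where "r = sqrt (real N)"
    \<comment> \<open>The factor \<open>W <#> K\<close> should have about \<open>r\<close> elements,
      hence \<open>s\<close> near \<open>r / b\<close>. Rounding up at most doubles this because
      \<open>b \<le> r\<close>, and \<open>s \<le> p\<close> because
      \<open>r < p * b\<close>.\<close>
    define s where "s = nat \<lceil>r / b\<rceil>"
    have b0: "b \<ge> 1" and r0: "r \<ge> 1"
      using K0 N0 by (auto simp: b_def r_def)
    have rr: "r * r = real N"
      by (simp add: r_def)
    have "b * b \<le> real N"
      using cardK by (simp add: b_def flip: of_nat_mult)
    then have br: "b \<le> r"
      using real_le_rsqrt[of b N] by (simp add: r_def power2_eq_square)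
    have "real N < (p * b) * (p * b)"
    proof -
      have "N < (p * card K) * (p * card K)"
        using L_large L_eq mult_le_mono[OF L_eq L_eq] by linarith
      then show ?thesis
        unfolding b_def by (metis of_nat_less_iff of_nat_mult)
    qed
    then have rp: "r < p * b"
      using b0 real_sqrt_less_mono[of "real N" "(p * b) * (p * b)"] by (simp add: r_def)
    have sge: "r / b \<le> s" and s2: "s \<le> 2 * (r / b)"
      using br b0 real_ceiling_le_double[of "r / b"] unfolding s_def by (auto simp: le_nat_iff)
    have s0: "s > 0"
      using sge r0 b0 by (metis divide_pos_pos gr0I less_le_trans not_less of_nat_0 zero_less_one)
    have sp: "s \<le> p"
      unfolding s_def using rp b0 by (simp add: ceiling_le_iff pos_divide_le_eq nat_le_iff)
    obtain T where T: "T \<subseteq> carrier G" "card T * card L = N" "L <#> T = carrier G"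
      using exists_transversal[OF fin subL] unfolding N_def by blast
    have finT: "finite T"
      using finite_subset[OF T(1) fin] .
    \<comment> \<open>Splitting an exponent \<open>i < p\<close> into a multiple of \<open>s\<close> and a remainder balances the two factors.\<close>
    define V where "V = (\<lambda>j. x [^] (s * j)) ` {..p div s}"
    define W where "W = (\<lambda>i. x [^] i) ` {..<s}"
    have V: "V \<subseteq> carrier G" "finite V" "card V \<le> p div s + 1"
      using x card_image_le[of "{..p div s}"] by (auto simp: V_def)
    have W: "W \<subseteq> carrier G" "finite W" "card W \<le> s"
      using x card_image_le[of "{..<s}"] by (auto simp: W_def)
    have TV: "T <#> V \<subseteq> carrier G" and WK: "W <#> K \<subseteq> carrier G"
      using setmult_subset_G[OF T(1) V(1)] setmult_subset_G[OF W(1) subgroup.subset[OF subK]]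
      by simp_all
    have "g \<in> (T <#> V) <#> (W <#> K)" if g: "g \<in> carrier G" for g
    proof -
      obtain t l where t: "t \<in> T" "l \<in> L" "g = l \<otimes> t"
        using g unfolding T(3)[symmetric] by (auto simp: set_mult_def)
      then obtain i k where ik: "i < p" "k \<in> K" "l = x [^] i \<otimes> k"
        using L_pow by blast
      have c: "t \<in> carrier G" "k \<in> carrier G"
        using t(1) ik(2) T(1) subgroup.mem_carrier[OF subK] by auto
      have "x [^] i = x [^] (s * (i div s)) \<otimes> x [^] (i mod s)"
        using x by (simp add: nat_pow_mult)
      \<comment> \<open>Commutativity moves \<open>t\<close> to the front, which leaves the two
        parts of the power of \<open>x\<close> adjacent, one for each factor.\<close>
      then have "g = (t \<otimes> x [^] (s * (i div s))) \<otimes> (x [^] (i mod s) \<otimes> k)"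
        using t ik c x by (simp add: m_assoc m_comm m_lcomm)
      moreover have "x [^] (s * (i div s)) \<in> V"
        using ik by (auto simp: V_def div_le_mono)
      moreover have "x [^] (i mod s) \<in> W"
        using s0 by (auto simp: W_def)
      ultimately show ?thesis
        using t ik unfolding set_mult_def by blast
    qed
    then have "generating_pair G (carrier G) (T <#> V, W <#> K)"
      using TV WK setmult_subset_G[OF TV WK] by (auto simp: generating_pair_def)
    moreover have "real (card (W <#> K)) \<le> 2 * r"
    proof -
      have "card (W <#> K) \<le> s * card K"
        using card_set_mult_le[OF W(2) finK] W(3) mult_le_mono1 le_trans by blast
      then have "real (card (W <#> K)) \<le> s * b"
        unfolding b_def by (metis of_nat_le_iff of_nat_mult)
      also have "\<dots> \<le> 2 * (r / b) * b"
        using s2 b0 by (intro mult_right_mono) auto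
      finally show ?thesis
        using b0 by simp
    qed
    moreover have "real (card (T <#> V)) \<le> 2 * r"
    proof -
      have "card T * (p * card K) \<le> N"
        using T(2) cardL by (metis mult_le_mono2)
      then have Tp: "card T * (p * b) \<le> r * r"
        unfolding b_def rr by (metis of_nat_le_iff of_nat_mult)
      have "card (T <#> V) \<le> card T * (p div s + 1)"
        using card_set_mult_le[OF finT V(2)] V(3) mult_le_mono2 le_trans by blast
      \<comment> \<open>Since \<open>s \<le> p\<close>, the extra block from rounding costs only a
        factor 2: the left side is at most \<open>p + s\<close>.\<close>
      moreover have "s * (p div s + 1) \<le> 2 * p"
        using sp times_div_less_eq_dividend[of s p] unfolding distrib_left by linarith
      ultimately have "card (T <#> V) * s \<le> card T * (p div s + 1) * s"
        and "card T * (s * (p div s + 1)) \<le> card T * (2 * p)"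
        by (simp_all del: add_Suc_right)
      then have "s * card (T <#> V) \<le> card T * (2 * p)"
        by (simp only: mult_ac)
      then have "real s * card (T <#> V) \<le> card T * (2 * p)"
        by (metis of_nat_le_iff of_nat_mult)
      then have "(s * b) * card (T <#> V) \<le> 2 * (card T * (p * b))"
        using b0 mult_right_mono[of "real s * card (T <#> V)" "card T * (2 * p)" b]
        by (simp add: algebra_simps)
      also have "\<dots> \<le> 2 * (r * r)"
        using Tp by simp
      finally have 1: "(s * b) * card (T <#> V) \<le> 2 * (r * r)" .
      have "r \<le> s * b"
        using sge b0 by (simp add: pos_divide_le_eq)
      then have "r * card (T <#> V) \<le> (s * b) * card (T <#> V)"
        by (intro mult_right_mono) auto
      then have "r * card (T <#> V) \<le> r * (2 * r)"
        using 1 by linarith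
      then show ?thesis
        using r0 by simp
    qed
    ultimately show ?thesis
      unfolding r_def N_def by (intro exI[of _ "T <#> V"] exI[of _ "W <#> K"]) auto
  qed
qed

section \<open>Generating pairs in arbitrary groups by greedy covering\<close>

text \<open>Double counting: each \<open>u\<close> lies in \<open>A #> b\<close> for exactly
  \<open>card A\<close> choices of \<open>b\<close>, namely \<open>b = inv a \<otimes> u\<close>. So
  the intersections with \<open>U\<close> have total size \<open>card A * card U\<close>, and some
  translate reaches the average.\<close>

lemma (in group) exists_translate_covering:
  assumes fin: "finite (carrier G)" and A: "A \<subseteq> carrier G" and U: "U \<subseteq> carrier G"
  shows "\<exists>b\<in>carrier G. card A * card U \<le> order G * card (U \<inter> (A #> b))"
proof -
  have "card {b \<in> carrier G. u \<in> A #> b} = card A" if u: "u \<in> carrier G" for u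
  proof -
    have "bij_betw (\<lambda>a. inv a \<otimes> u) A {b \<in> carrier G. u \<in> A #> b}"
    proof (rule bij_betwI')
      fix a a' assume "a \<in> A" "a' \<in> A"
      then show "(inv a \<otimes> u = inv a' \<otimes> u) = (a = a')"
        using A u by (metis inv_closed inv_inv r_cancel subsetD)
    next
      fix a assume a: "a \<in> A"
      then have "u = a \<otimes> (inv a \<otimes> u)"
        using A u by (metis inv_closed m_assoc r_inv l_one subsetD)
      then show "inv a \<otimes> u \<in> {b \<in> carrier G. u \<in> A #> b}"
        using a A u by (auto simp: r_coset_def)
    next
      fix b assume "b \<in> {b \<in> carrier G. u \<in> A #> b}"
      then obtain a where "a \<in> A" "b \<in> carrier G" "u = a \<otimes> b"
        by (auto simp: r_coset_def)
      then show "\<exists>a\<in>A. b = inv a \<otimes> u"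
        using A u by (intro bexI[of _ a]) (auto simp: inv_solve_left)
    qed
    then show ?thesis
      by (simp add: bij_betw_same_card)
  qed
  then have sum: "(\<Sum>b\<in>carrier G. card {u \<in> U. u \<in> A #> b}) = card A * card U"
    using U fin finite_subset by (intro sum_multicount) (auto simp: subset_iff)
  show ?thesis
  proof (rule ccontr)
    assume "\<not> ?thesis"
    then have "(\<Sum>b\<in>carrier G. order G * card {u \<in> U. u \<in> A #> b}) < (\<Sum>b\<in>carrier G. card A * card U)"
      using fin one_closed by (intro sum_strict_mono) (auto simp: Int_def not_le)
    then show False
      using sum by (simp add: order_def flip: sum_distrib_left)
  qed
qed

text \<open>Adding a translate of at least average coverage removes a fraction
  \<open>card A / order G\<close> or more of the elements still uncovered; this is repeated
  \<open>t\<close> times.\<close>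

lemma (in group) greedy_cover:
  assumes fin: "finite (carrier G)" and A: "A \<subseteq> carrier G"
  shows "\<exists>B. B \<subseteq> carrier G \<and> card B \<le> t \<and>
    real (card (carrier G - (A <#> B))) \<le> order G * (1 - card A / order G) ^ t"
proof (induction t)
  case 0
  show ?case
    by (intro exI[of _ "{}"]) (auto simp: set_mult_def order_def)
next
  case (Suc t)
  then obtain B where B: "B \<subseteq> carrier G" "card B \<le> t"
    and le: "real (card (carrier G - (A <#> B))) \<le> order G * (1 - card A / order G) ^ t"
    by blast
  define U where "U = carrier G - (A <#> B)"
  have N: "real (order G) > 0"
    using fin order_gt_0_iff_finite by simp
  have finB: "finite B"
    using B fin finite_subset by blast
  obtain b where b: "b \<in> carrier G" "card A * card U \<le> order G * card (U \<inter> (A #> b))"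
    using exists_translate_covering[OF fin A, of U] by (auto simp: U_def)
  have "carrier G - (A <#> insert b B) = U - U \<inter> (A #> b)"
    by (auto simp: U_def set_mult_def r_coset_def)
  moreover have finU: "finite U"
    using fin by (simp add: U_def)
  ultimately have "card (carrier G - (A <#> insert b B)) = card U - card (U \<inter> (A #> b))"
    by (simp add: card_Diff_subset)
  then have "real (card (carrier G - (A <#> insert b B))) = card U - real (card (U \<inter> (A #> b)))"
    using finU by (simp add: of_nat_diff card_mono)
  also have "\<dots> \<le> card U * (1 - card A / order G)"
  proof -
    have "real (card A) * card U \<le> real (order G) * card (U \<inter> (A #> b))"
      using b(2) by (metis of_nat_le_iff of_nat_mult)
    then show ?thesis
      using N by (simp add: field_simps)
  qed
  also have "\<dots> \<le> order G * (1 - card A / order G) ^ t * (1 - card A / order G)"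
  proof (rule mult_right_mono)
    show "real (card U) \<le> order G * (1 - card A / order G) ^ t"
      using le by (simp add: U_def)
    have "card A \<le> order G"
      using A fin by (simp add: order_def card_mono)
    then show "0 \<le> 1 - card A / order G"
      using N by simp
  qed
  finally show ?case
    using B b finB by (intro exI[of _ "insert b B"]) (auto simp: mult_ac card_insert_if)
qed

text \<open>Take any \<open>A\<close> of size \<open>a\<close>, about \<open>sqrt (N * L)\<close>,
  and \<open>a\<close> greedy translates. The number of uncovered elements is at most
  \<open>N * exp (- (a * a / N))\<close>, hence at most \<open>N * exp (- L)\<close>, which is below
  1 and therefore 0. The maximum with 1 covers the trivial group, where the logarithm
  vanishes.\<close>

lemma (in group) generating_pair_sqrt_log:
  assumes fin: "finite (carrier G)"
  shows "\<exists>S1 S2. generating_pair G (carrier G) (S1, S2) \<and>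
    max (card S1) (card S2) \<le> 2 * sqrt (order G * max 1 (log 2 (order G)))"
proof -
  define N where "N = real (order G)"
  define L where "L = max 1 (log 2 N)"
  have N: "N \<ge> 1"
    using fin order_gt_0_iff_finite unfolding N_def by (simp add: Suc_leI)
  have L: "L \<ge> 1" "L \<le> N"
    using N log_le_iff[of 2 N N] less_exp[of "order G"]
    by (auto simp: L_def N_def powr_realpow less_imp_le simp flip: of_nat_less_iff)
  \<comment> \<open>Strictness is what pushes the count of uncovered elements below 1. It comes from
    \<open>ln 2 < 1\<close>, or from \<open>L \<ge> 1\<close> when \<open>N = 1\<close>.\<close>
  have lnL: "ln N < L"
  proof (cases "N = 1")
    case False
    then have "ln N > 0" using N by simp
    then have "ln N * ln 2 < ln N * 1"
      using ln_2_less_1 by (intro mult_strict_left_mono) auto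
    then have "ln N < log 2 N"
      by (simp add: log_def field_simps)
    then show ?thesis by (simp add: L_def)
  qed (use L in simp)
  define a where "a = nat \<lceil>sqrt (N * L)\<rceil>"
  have NL1: "1 \<le> sqrt (N * L)"
    using N L mult_mono[of 1 N 1 L] by simp
  have a2: "a \<le> 2 * sqrt (N * L)"
    unfolding a_def using NL1 by (rule real_ceiling_le_double)
  have age: "sqrt (N * L) \<le> a"
    unfolding a_def by linarith
  \<comment> \<open>\<open>L \<le> N\<close> ensures that the group is large enough to contain a
    subset of size \<open>a\<close>.\<close>
  have "N * L \<le> N * N"
    using N L by (intro mult_left_mono) auto
  then have "sqrt (N * L) \<le> N"
    using N by (intro real_le_lsqrt) (auto simp: power2_eq_square)
  then have "a \<le> card (carrier G)"
    unfolding a_def N_def order_def by linarith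
  then obtain A where A: "A \<subseteq> carrier G" "card A = a"
    using obtain_subset_with_card_n by metis
  obtain B where B: "B \<subseteq> carrier G" "card B \<le> a"
    and le: "real (card (carrier G - (A <#> B))) \<le> N * (1 - a / N) ^ a"
    using greedy_cover[OF fin A(1), of a] by (auto simp: A N_def)
  have aN: "a / N \<le> 1"
    using \<open>a \<le> card (carrier G)\<close> N by (simp add: N_def order_def)
  have "(1 - a / N) ^ a \<le> exp (- (a / N)) ^ a"
    using aN exp_ge_add_one_self[of "- (a / N)"] by (intro power_mono) auto
  also have "\<dots> = exp (- (a * a / N))"
    by (simp flip: exp_of_nat_mult)
  also have "\<dots> \<le> exp (- L)"
  proof -
    have "N * L \<le> a * a"
      using age N L power_mono[OF age, of 2] by (simp add: power2_eq_square)
    then show ?thesis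
      using N by (simp add: field_simps)
  qed
  also have "\<dots> < exp (- ln N)"
    using lnL by simp
  also have "\<dots> = 1 / N"
    using N by (simp add: exp_minus inverse_eq_divide)
  finally have "N * (1 - a / N) ^ a < 1"
    using N by (simp add: field_simps)
  then have "card (carrier G - (A <#> B)) = 0"
    using le by linarith
  then have "carrier G \<subseteq> A <#> B"
    using fin by simp
  then have "generating_pair G (carrier G) (A, B)"
    using A B setmult_subset_G[of A B] by (auto simp: generating_pair_def)
  moreover have "real (max (card A) (card B)) \<le> 2 * sqrt (N * L)"
    using a2 A B by linarith
  ultimately show ?thesis
    unfolding N_def L_def by blast
qed

section \<open>Transfer of both bounds to subgroups\<close>

lemma (in group) subgroup_generating_pair_sqrt_log:
  assumes "finite (carrier G)" "subgroup K G"
  shows "\<exists>S1 S2. generating_pair G K (S1, S2) \<and>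
    max (card S1) (card S2) \<le> 2 * sqrt (card K * max 1 (log 2 (card K)))"
proof -
  interpret K: group "G\<lparr>carrier := K\<rparr>"
    using assms(2) subgroup_imp_group by blast
  show ?thesis
    using K.generating_pair_sqrt_log finite_subset[OF subgroup.subset[OF assms(2)] assms(1)]
    by (simp add: generating_pair_def set_mult_def order_def)
qed

lemma (in comm_group) subgroup_generating_pair_sqrt:
  assumes "finite (carrier G)" "subgroup K G"
  shows "\<exists>S1 S2. generating_pair G K (S1, S2) \<and> max (card S1) (card S2) \<le> 2 * sqrt (card K)"
proof -
  interpret K: comm_group "G\<lparr>carrier := K\<rparr>"
    using assms(2) by (intro group.group_comm_groupI)
      (auto intro: subgroup_imp_group m_comm subgroup.mem_carrier)
  show ?thesis
    using K.generating_pair_sqrt finite_subset[OF subgroup.subset[OF assms(2)] assms(1)]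
    by (simp add: generating_pair_def set_mult_def order_def)
qed

section \<open>Closed form and monotonicity of the starting index\<close>

text \<open>The closed form has the shape of \<open>final_index\<close>, so both ends of a search,
  as well as the critical index, become values of one monotone function of a group order.\<close>

lemma initial_index_eq:
  assumes "n > 0"
  shows "initial_index n = \<lceil>log 2 (real n)\<rceil> - 1"
proof -
  let ?l = "initial_index n"
  have n: "2 powi ?l < real n" "real n \<le> 2 powi (?l + 1)"
    using ex_initial_index[OF assms] by auto
  have "of_int ?l < log 2 (real n)"
    using n(1) assms by (simp add: less_log_iff powr_real_of_int')
  moreover have "log 2 (real n) \<le> of_int (?l + 1)"
    using n(2) assms by (simp add: log_le_iff powr_real_of_int' flip: of_int_add)
  ultimately have "\<lceil>log 2 (real n)\<rceil> = ?l + 1"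
    by (intro ceiling_unique) auto
  then show ?thesis
    by simp
qed

lemma initial_index_mono:
  assumes "0 < a" "a \<le> b"
  shows "initial_index a \<le> initial_index b"
proof -
  have "log 2 (real a) \<le> log 2 (real b)"
    using assms by simp
  then show ?thesis
    using assms ceiling_mono[of "log 2 (real a)" "log 2 (real b)"] by (simp add: initial_index_eq)
qed

section \<open>One search: admissible subgroups, existence of collisions, and cost\<close>

text \<open>\<open>A\<close> abstracts the quality of generating pairs, so that the abelian and the
  non-abelian case share one analysis. The bound is demanded only for subgroups of order at most
  \<open>2 * order G / card H\<close>; this lets \<open>A\<close> contain the logarithm of the index
  of \<open>H\<close> instead of that of the group order.\<close>

locale subgroup_search = group G for G :: "('a, 'b) monoid_scheme" (structure) +
  fixes f :: "'a \<Rightarrow> 's" and H :: "'a set" and c :: "('a, 's) choices" and G0 :: "'a set" and A :: real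
  assumes fin: "finite (carrier G)"
    and subH: "subgroup H G"
    and hides: "hides G f H"
    and subG0: "subgroup G0 G"
    and card_G0: "card G0 * card H = order G"
    and G0_H: "G0 \<inter> H = {\<one>}"
    and valid: "valid_choices G c"
    and pair_bound: "\<And>K. subgroup K G \<Longrightarrow> card K * card H \<le> 2 * order G \<Longrightarrow>
      \<exists>S1 S2. generating_pair G K (S1, S2) \<and> real (max (card S1) (card S2)) \<le> A * sqrt (card K)"
begin

text \<open>The index below which no search runs a pass. It is -1 when \<open>H\<close> is
  trivial.\<close>

definition critical_index :: int where
  "critical_index = initial_index (card H)"

text \<open>An upper bound for the square root of the order of any subgroup admissible at
  \<open>k\<close>, thus the cost of the pass up to a constant factor.\<close>

definition scale :: "int \<Rightarrow> real" where
  "scale k = sqrt (order G / 2 powi k)"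

lemma card_pos: "subgroup K G \<Longrightarrow> card K > 0"
  using subgroup.finite_imp_card_positive fin by blast

lemma finite_subgroup: "subgroup K G \<Longrightarrow> finite K"
  using finite_subset[OF subgroup.subset fin] .

lemma card_H_bounds: "2 powi critical_index < real (card H)" "real (card H) \<le> 2 powi (critical_index + 1)"
  using ex_initial_index[OF card_pos[OF subH]] by (auto simp: critical_index_def)

lemma A_nonneg: "0 \<le> A"
proof -
  obtain S1 S2 :: "'a set" where "real (max (card S1) (card S2)) \<le> A * sqrt (card G0)"
    using pair_bound[OF subG0] card_G0 by auto
  then have "0 \<le> A * sqrt (card G0)"
    using order_trans[OF of_nat_0_le_iff] by blast
  then show ?thesis
    using card_pos[OF subG0] by (simp add: zero_le_mult_iff)
qed

lemma scale_nonneg: "0 \<le> scale k"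
  by (simp add: scale_def)

text \<open>The geometric sum in telescoping form: \<open>scale\<close> grows by the factor
  \<open>sqrt 2\<close> when the index drops by one, and \<open>sqrt 2 - 1\<close> is at least
  1/3.\<close>

lemma scale_le_diff: "scale k \<le> 3 * (scale (k - 1) - scale k)"
proof -
  have "scale (k - 1) = sqrt 2 * scale k"
    by (simp add: scale_def power_int_diff real_sqrt_mult real_sqrt_divide)
  moreover have "4 / 3 \<le> sqrt (2::real)"
    by (rule real_le_rsqrt) (simp add: power2_eq_square)
  then have "4 / 3 * scale k \<le> sqrt 2 * scale k"
    using scale_nonneg by (rule mult_right_mono)
  ultimately show ?thesis
    by simp
qed

lemma scale_antimono: "j \<le> k \<Longrightarrow> scale k \<le> scale j"
  unfolding scale_def
  by (intro real_sqrt_le_mono divide_left_mono power_int_increasing) auto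

text \<open>The upper bound on \<open>card H\<close> is four times
  \<open>2 powi (critical_index - 1)\<close>; the square root turns 4 into 2.\<close>

lemma scale_critical_le: "scale (critical_index - 1) \<le> 2 * sqrt (order G / card H)"
proof -
  have m0: "0 < real (card H)"
    using card_pos[OF subH] by simp
  have "4 * 2 powi (critical_index - 1) = (2::real) powi (critical_index + 1)"
    by (simp add: power_int_add power_int_diff)
  then have "real (card H) \<le> 4 * 2 powi (critical_index - 1)"
    using card_H_bounds(2) by simp
  then have "order G / 2 powi (critical_index - 1) \<le> order G / (real (card H) / 4)"
    using m0 by (intro divide_left_mono) auto
  then have "scale (critical_index - 1) \<le> sqrt (2\<^sup>2 * (order G / card H))"
    unfolding scale_def by (intro real_sqrt_le_mono) (simp add: field_simps)
  then show ?thesis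
    unfolding real_sqrt_mult by simp
qed

lemma admissible_card:
  assumes "admissible G H1 k K"
  shows "real (card K) \<le> order G / 2 powi k"
proof -
  have "real (card K) \<le> order G / (of_int \<lfloor>(2::real) powi k\<rfloor> + 1)"
    using assms by (simp add: admissible_def)
  also have "\<dots> \<le> order G / 2 powi k"
  proof (rule divide_left_mono)
    show le: "2 powi k \<le> of_int \<lfloor>(2::real) powi k\<rfloor> + (1::real)"
      by linarith
    have "(0::real) < 2 powi k" by simp
    then show "0 < (of_int \<lfloor>(2::real) powi k\<rfloor> + 1) * (2::real) powi k"
      using le by (intro mult_pos_pos) linarith+
  qed simp
  finally show ?thesis .
qed

text \<open>The order of \<open>G0\<close> is \<open>order G / card H\<close>. As
  \<open>card H\<close> is an integer above \<open>2 powi critical_index\<close>, it is at least the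
  floor of that power plus one, which gives the upper end of the range; the upper bound on
  \<open>card H\<close> gives the lower end.\<close>

lemma admissible_critical:
  assumes "H1 \<subseteq> H" "subgroup H1 G"
  shows "admissible G H1 critical_index G0"
proof -
  have m0: "0 < real (card H)"
    using card_pos[OF subH] by simp
  have "real (card G0) * real (card H) = real (order G)"
    using card_G0 by (metis of_nat_mult)
  then have c: "real (card G0) = order G / card H"
    using m0 by (simp add: field_simps)
  have "\<lfloor>(2::real) powi critical_index\<rfloor> < int (card H)"
    using card_H_bounds(1) by (simp add: floor_less_iff)
  then have "of_int \<lfloor>(2::real) powi critical_index\<rfloor> + 1 \<le> real (card H)"
    by linarith
  moreover have "0 < of_int \<lfloor>(2::real) powi critical_index\<rfloor> + (1::real)"
  proof -
    have "(0::real) < 2 powi critical_index" by simp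
    then show ?thesis by linarith
  qed
  ultimately have "real (card G0) \<le> order G / (of_int \<lfloor>(2::real) powi critical_index\<rfloor> + 1)"
    unfolding c using m0 by (intro divide_left_mono) auto
  moreover have "order G / 2 powi (critical_index + 1) \<le> real (card G0)"
    unfolding c using m0 card_H_bounds(2) by (intro divide_left_mono) auto
  moreover have "G0 \<inter> H1 = {\<one>}"
    using G0_H assms subgroup.one_closed[OF subG0] subgroup.one_closed[OF assms(2)] by blast
  ultimately show ?thesis
    using subG0 by (simp add: admissible_def)
qed

lemma new_collision_difference:
  assumes "R \<subseteq> carrier G" "new_collision G H1 R (restrict f R) (z, y)"
  shows "inv z \<otimes> y \<in> H - H1"
proof -
  have "z \<in> carrier G" "y \<in> carrier G" "f z = f y" "inv z \<otimes> y \<notin> H1"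
    using assms by (auto simp: new_collision_def)
  then show ?thesis
    using hides by (auto simp: hides_def)
qed

lemma exists_new_collision:
  assumes H1: "subgroup H1 G" "H1 \<subseteq> H" "H1 \<noteq> H"
    and K: "subgroup K G" "K \<inter> H1 = {\<one>}" "card G0 \<le> card K"
    and pair: "generating_pair G K (S1, S2)"
    and g: "g \<in> carrier G" "K <#> H1 \<noteq> carrier G \<Longrightarrow> g \<notin> K <#> H1"
    and R: "R = set_inv S1 \<union> S2 \<union> (set_inv S1 <#> {g})"
  shows "\<exists>p. new_collision G H1 R (restrict f R) p"
proof -
  have S: "S1 \<subseteq> K" "S2 \<subseteq> K" "S1 <#> S2 = K"
    using pair by (auto simp: generating_pair_def)
  have Kc: "K \<subseteq> carrier G"
    using K(1) by (rule subgroup.subset)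
  have f_eq: "f z = f y" if "z \<in> carrier G" "y \<in> carrier G" "inv z \<otimes> y \<in> H" for z y
    using that hides by (simp add: hides_def)
  have split: "\<exists>x\<in>S1. \<exists>y\<in>S2. a = x \<otimes> y" if "a \<in> K" for a
    using that S(3) by (auto simp: set_mult_def)
  show ?thesis
  proof (cases "K \<inter> H = {\<one>}")
    case False
    then obtain h where h: "h \<in> K" "h \<in> H" "h \<noteq> \<one>"
      using subgroup.one_closed[OF K(1)] subgroup.one_closed[OF subH] by blast
    \<comment> \<open>\<open>K\<close> meets \<open>H1\<close> only in the identity.\<close>
    then have "h \<notin> H1"
      using K(2) by blast
    obtain x y where xy: "x \<in> S1" "y \<in> S2" "h = x \<otimes> y"
      using split[OF h(1)] by blast
    have car: "x \<in> carrier G" "y \<in> carrier G"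
      using xy S Kc by auto
    have "inv x \<in> R" "y \<in> R"
      using xy by (auto simp: R SET_INV_def)
    moreover have "inv (inv x) \<otimes> y = h"
      using xy car by simp
    ultimately have "new_collision G H1 R (restrict f R) (inv x, y)"
      using f_eq[of "inv x" y] car h \<open>h \<notin> H1\<close> by (simp add: new_collision_def)
    then show ?thesis ..
  next
    case True
    have KH: "K <#> H \<subseteq> carrier G"
      using setmult_subset_G[OF Kc subgroup.subset[OF subH]] .
    \<comment> \<open>The product has \<open>card K * card H\<close> elements, and \<open>G0\<close>
      in place of \<open>K\<close> would already give the full order.\<close>
    have "card (carrier G) \<le> card (K <#> H)"
      using card_set_mult_subgroups[OF K(1) subH True] card_G0 mult_le_mono1[OF K(3), of "card H"]
      by (simp add: order_def)
    then have eq: "K <#> H = carrier G"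
      using card_seteq[OF fin KH] by blast
    have "card H1 < card H"
      using H1 finite_subgroup[OF subH] by (intro psubset_card_mono) auto
    \<comment> \<open>Both products are direct and \<open>H1\<close> is smaller than
      \<open>H\<close>, so \<open>K <#> H1\<close> is proper and \<open>g\<close> was taken outside
      it.\<close>
    then have "card (K <#> H1) < card (K <#> H)"
      using card_set_mult_subgroups[OF K(1) subH True] card_pos[OF K(1)]
        card_set_mult_subgroups[OF K(1) H1(1) K(2)] by simp
    then have "g \<notin> K <#> H1"
      using g(2) eq by (metis less_irrefl)
    obtain a h where ah: "a \<in> K" "h \<in> H" "g = a \<otimes> h"
      using g(1) unfolding eq[symmetric] by (auto simp: set_mult_def)
    obtain x y where xy: "x \<in> S1" "y \<in> S2" "a = x \<otimes> y"
      using split[OF ah(1)] by blast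
    have car: "x \<in> carrier G" "y \<in> carrier G" "a \<in> carrier G" "h \<in> carrier G"
      using xy S Kc ah subgroup.subset[OF subH] by auto
    have "h \<notin> H1"
      using ah \<open>g \<notin> K <#> H1\<close> by (auto simp: set_mult_def)
    then have h': "inv h \<in> H" "inv h \<notin> H1"
      using ah(2) car subgroup.m_inv_closed[OF subH] subgroup.m_inv_closed[OF H1(1), of "inv h"]
      by auto
    have "inv x \<otimes> g \<in> R" "y \<in> R"
      using xy by (auto simp: R SET_INV_def set_mult_def)
    \<comment> \<open>The product is \<open>inv g \<otimes> x \<otimes> y\<close>, that is
      \<open>inv (a \<otimes> h) \<otimes> a\<close>.\<close>
    moreover have "inv (inv x \<otimes> g) \<otimes> y = inv h"
      using car by (simp add: ah(3) xy(3) inv_mult_group m_assoc)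
    ultimately have "new_collision G H1 R (restrict f R) (inv x \<otimes> g, y)"
      using f_eq[of "inv x \<otimes> g" y] car g(1) h' by (simp add: new_collision_def)
    then show ?thesis ..
  qed
qed

lemma card_query_set_le:
  assumes "finite S1" "finite S2"
  shows "card (set_inv S1 \<union> S2 \<union> (set_inv S1 <#> {g})) \<le> 3 * max (card S1) (card S2)"
proof -
  have eq: "set_inv S1 = (\<lambda>x. inv x) ` S1"
    by (auto simp: SET_INV_def)
  have i: "finite (set_inv S1)" "card (set_inv S1) \<le> card S1"
    using assms by (simp_all add: eq card_image_le)
  have "card (set_inv S1 <#> {g}) \<le> card S1"
    using card_set_mult_le(2)[OF i(1), of "{g}"] i(2) by simp
  then show ?thesis
    using i card_Un_le[of "set_inv S1 \<union> S2" "set_inv S1 <#> {g}"] card_Un_le[of "set_inv S1" S2]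
    by linarith
qed

lemma search_pass_correct:
  assumes H1: "subgroup H1 G" "H1 \<subseteq> H" and k: "critical_index \<le> k"
  obtains r q where "search_pass G c H1 f k = (r, q)" "real q \<le> 3 * A * scale k"
    "\<And>z y. r = Collision z y \<Longrightarrow> inv z \<otimes> y \<in> H - H1"
    "H1 \<noteq> H \<Longrightarrow> k = critical_index \<Longrightarrow> r \<noteq> No_New_Collision"
proof (cases "\<exists>K. admissible G H1 k K")
  case False
  then have "search_pass G c H1 f k = (No_New_Collision, 0)"
    by (simp add: search_pass_def)
  \<comment> \<open>A pass without admissible subgroup cannot be the critical one, where
    \<open>G0\<close> is admissible.\<close>
  then show ?thesis
    using False admissible_critical[OF H1(2,1)] A_nonneg scale_nonneg by (intro that) auto
next
  case True
  define K where "K = pick_subgroup c H1 k"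
  obtain S1 S2 where S: "pick_pair c H1 k K = (S1, S2)"
    by force
  define g where "g = (if K <#> H1 = carrier G then \<one> else pick_outside c H1 k K (S1, S2))"
  define R where "R = set_inv S1 \<union> S2 \<union> (set_inv S1 <#> {g})"
  define zy where "zy = pick_collision c H1 k R (restrict f R)"
  have pass: "search_pass G c H1 f k =
     (if \<exists>p. new_collision G H1 R (restrict f R) p then (Collision (fst zy) (snd zy), card R)
      else (No_New_Collision, card R))"
    using True S by (simp add: search_pass_def Let_def split_beta K_def g_def R_def zy_def)
  have "is_arg_max card (admissible G H1 k) K"
    using valid True H1 unfolding valid_choices_def K_def by blast
  then have adm: "admissible G H1 k K" and K_max: "\<And>L. admissible G H1 k L \<Longrightarrow> card L \<le> card K"
    by (auto simp: is_arg_max_linorder)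
  then have subK: "subgroup K G" and KH1: "K \<inter> H1 = {\<one>}"
    by (auto simp: admissible_def)
  have "is_arg_min (\<lambda>(S1, S2). max (card S1) (card S2)) (generating_pair G K) (S1, S2)"
    using valid H1 subK unfolding valid_choices_def S[symmetric] by blast
  then have pair: "generating_pair G K (S1, S2)"
    and S_min: "\<And>T1 T2. generating_pair G K (T1, T2) \<Longrightarrow>
      max (card S1) (card S2) \<le> max (card T1) (card T2)"
    unfolding is_arg_min_linorder by auto
  have SK: "S1 \<subseteq> K" "S2 \<subseteq> K"
    using pair by (auto simp: generating_pair_def)
  have g: "g \<in> carrier G" "K <#> H1 \<noteq> carrier G \<Longrightarrow> g \<notin> K <#> H1"
    using valid H1 subK unfolding valid_choices_def g_def by auto
  have Sc: "S1 \<subseteq> carrier G" "S2 \<subseteq> carrier G"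
    using SK subgroup.subset[OF subK] by auto
  then have Rc: "R \<subseteq> carrier G"
    using g(1) by (auto simp: R_def SET_INV_def set_mult_def)
  have card_K: "real (card K) \<le> order G / 2 powi k"
    using adm by (rule admissible_card)
  have "real (card R) \<le> 3 * (A * sqrt (card K))"
  proof -
    \<comment> \<open>The hypothesis of \<open>pair_bound\<close>: above the critical index the two
      dyadic estimates lose at most a factor 2.\<close>
    have "real (card K) * card H \<le> order G / 2 powi critical_index * 2 powi (critical_index + 1)"
    proof (rule mult_mono)
      show "real (card K) \<le> order G / 2 powi critical_index"
        using k by (intro order_trans[OF card_K] divide_left_mono power_int_increasing) auto
    qed (use card_H_bounds in auto)
    also have "\<dots> = 2 * order G"
      by (simp add: power_int_add)
    finally have "real (card K * card H) \<le> real (2 * order G)"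
      by simp
    then have "card K * card H \<le> 2 * order G"
      by (simp only: of_nat_le_iff)
    then obtain T1 T2 where "generating_pair G K (T1, T2)"
      "real (max (card T1) (card T2)) \<le> A * sqrt (card K)"
      using pair_bound[OF subK] by blast
    then have "real (max (card S1) (card S2)) \<le> A * sqrt (card K)"
      using S_min by (meson of_nat_le_iff order_trans)
    moreover have "card R \<le> 3 * max (card S1) (card S2)"
      unfolding R_def using finite_subset[OF Sc(1) fin] finite_subset[OF Sc(2) fin]
      by (rule card_query_set_le)
    then have "real (card R) \<le> 3 * real (max (card S1) (card S2))"
      by (metis of_nat_le_iff of_nat_mult of_nat_numeral)
    ultimately show ?thesis
      by linarith
  qed
  also have "\<dots> \<le> 3 * A * scale k"
    using card_K A_nonneg unfolding scale_def by (simp add: mult_left_mono)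
  finally have cost: "real (card R) \<le> 3 * A * scale k" .
  show ?thesis
  proof (cases "\<exists>p. new_collision G H1 R (restrict f R) p")
    case ex: True
    then have "new_collision G H1 R (restrict f R) zy"
      using valid unfolding valid_choices_def zy_def by blast
    then have "inv (fst zy) \<otimes> snd zy \<in> H - H1"
      using new_collision_difference[OF Rc] by (metis prod.collapse)
    then show ?thesis
      using ex pass cost by (intro that) auto
  next
    case none: False
    have "k \<noteq> critical_index" if "H1 \<noteq> H"
    proof
      assume "k = critical_index"
      then have "card G0 \<le> card K"
        using K_max admissible_critical[OF H1(2,1)] by blast
      then show False
        using exists_new_collision[OF H1 that subK KH1 _ pair g R_def] none by blast
    qed
    then show ?thesis
      using none pass cost by (intro that) auto
  qed
qed

text \<open>Induction upwards from just below the critical index. For proper \<open>H1\<close> that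
  base case is excluded, since the critical pass finds a collision; for \<open>H1 = H\<close> the
  loop has already ended there. Pass costs telescope, and 9 is the 3 of the pass bound times the 3
  of \<open>scale_le_diff\<close>.\<close>

lemma search_loop_correct:
  assumes H1: "subgroup H1 G" "H1 \<subseteq> H"
    and k: "critical_index - 1 \<le> k"
    and proper: "H1 \<noteq> H \<Longrightarrow> k0 \<le> critical_index \<and> critical_index \<le> k"
    and whole: "H1 = H \<Longrightarrow> critical_index \<le> k0"
  shows "\<exists>r q. search_loop G c H1 f k0 k = (r, q) \<and>
    real q \<le> 9 * A * (scale (critical_index - 1) - scale k) \<and>
    (\<forall>z y. r = Collision z y \<longrightarrow> inv z \<otimes> y \<in> H - H1) \<and> (H1 \<noteq> H \<longrightarrow> r \<noteq> No_New_Collision)"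
  using k proper
proof (induction k rule: int_ge_induct)
  case base
  then show ?case
    using whole by (cases "H1 = H") (simp_all add: search_loop.simps)
next
  case (step k)
  let ?s = "scale (critical_index - 1)"
  have s: "scale (k + 1) \<le> scale k" "scale k \<le> ?s"
    using step.hyps by (auto intro: scale_antimono)
  show ?case
  proof (cases "k0 \<le> k + 1")
    case False
    then have "H1 = H"
      using step.prems by fastforce
    then show ?thesis
      using False s A_nonneg by (simp add: search_loop.simps)
  next
    case True
    obtain r q where pass: "search_pass G c H1 f (k + 1) = (r, q)"
      and q: "real q \<le> 3 * A * scale (k + 1)"
      and coll: "\<And>z y. r = Collision z y \<Longrightarrow> inv z \<otimes> y \<in> H - H1"
      and crit: "H1 \<noteq> H \<Longrightarrow> k + 1 = critical_index \<Longrightarrow> r \<noteq> No_New_Collision"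
      using search_pass_correct[OF H1, of "k + 1"] step.hyps by (metis diff_le_eq)
    have "scale (k + 1) \<le> 3 * (scale k - scale (k + 1))"
      using scale_le_diff[of "k + 1"] by simp
    then have "3 * A * scale (k + 1) \<le> 3 * A * (3 * (scale k - scale (k + 1)))"
      using A_nonneg by (intro mult_left_mono) auto
    also have "\<dots> = 9 * A * (scale k - scale (k + 1))"
      by (simp add: algebra_simps)
    finally have q9: "real q \<le> 9 * A * (scale k - scale (k + 1))"
      using q by linarith
    show ?thesis
    proof (cases r)
      case (Collision z y)
      have "9 * A * (scale k - scale (k + 1)) \<le> 9 * A * (?s - scale (k + 1))"
        using s A_nonneg by (intro mult_left_mono) auto
      then show ?thesis
        using q9 coll pass True Collision by (simp add: search_loop.simps[of G c H1 f k0 "k + 1"])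
    next
      case No_New_Collision
      \<comment> \<open>An unsuccessful pass with proper \<open>H1\<close> was not at the critical
        index, so that index still lies ahead.\<close>
      then have "H1 \<noteq> H \<Longrightarrow> k0 \<le> critical_index \<and> critical_index \<le> k"
        using crit step.prems by force
      from step.IH[OF this] obtain r' q' where rest: "search_loop G c H1 f k0 k = (r', q')"
        "real q' \<le> 9 * A * (?s - scale k)"
        "\<forall>z y. r' = Collision z y \<longrightarrow> inv z \<otimes> y \<in> H - H1"
        "H1 \<noteq> H \<longrightarrow> r' \<noteq> No_New_Collision"
        by blast
      have "real (q + q') \<le> 9 * A * (?s - scale (k + 1))"
        using q9 rest(2) by (simp add: algebra_simps)
      moreover have "search_loop G c H1 f k0 (k + 1) = (r', q + q')"
        using pass True No_New_Collision rest(1)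
        by (simp add: search_loop.simps[of G c H1 f k0 "k + 1"])
      ultimately show ?thesis
        using rest(3,4) by blast
    qed
  qed
qed

section \<open>A complete search and the number of searches\<close>

lemma card_le_half:
  assumes "subgroup H1 G" "subgroup H2 G" "H1 \<subset> H2"
  shows "2 * card H1 \<le> card H2"
proof -
  interpret H2: group "G\<lparr>carrier := H2\<rparr>"
    using assms(2) by (rule subgroup_imp_group)
  have "subgroup H1 (G\<lparr>carrier := H2\<rparr>)"
    using assms by (simp add: subgroup_incl)
  then obtain d where d: "d * card H1 = card H2"
    using H2.lagrange by (auto simp: order_def)
  moreover have "card H1 < card H2"
    using assms finite_subgroup by (simp add: psubset_card_mono)
  ultimately have "d \<noteq> 0" "d \<noteq> 1"
    by (auto intro: gr0I)
  then have "2 * card H1 \<le> d * card H1"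
    by (intro mult_le_mono1) simp
  then show ?thesis
    using d by simp
qed

lemma find_new_collision_correct:
  assumes H1: "subgroup H1 G" "H1 \<subseteq> H"
  obtains r q where "find_new_collision G c H1 f = (r, q)"
    "real q \<le> 18 * A * sqrt (order G / card H)"
    "\<And>z y. r = Collision z y \<Longrightarrow> inv z \<otimes> y \<in> H - H1"
    "H1 \<noteq> H \<Longrightarrow> r \<noteq> No_New_Collision"
proof -
  let ?m1 = "if comm_group G then max 2 (card H1) else card H1"
  have m1: "?m1 > 0"
    using card_pos[OF H1(1)] by auto
  have k0: "final_index G H1 = initial_index ?m1"
    unfolding initial_index_eq[OF m1] final_index_def ..
  \<comment> \<open>A proper subgroup of \<open>H\<close> has at most half its order, so
    \<open>card H\<close> is at least 2 and also dominates \<open>max 2 (card H1)\<close>.\<close>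
  have "?m1 \<le> card H" if "H1 \<noteq> H"
  proof -
    have "2 * card H1 \<le> card H"
      using card_le_half[OF H1(1) subH] H1(2) that by blast
    then show ?thesis
      using card_pos[OF H1(1)] by simp
  qed
  then have proper: "H1 \<noteq> H \<Longrightarrow> final_index G H1 \<le> critical_index"
    unfolding k0 critical_index_def using m1 by (rule initial_index_mono[rotated])
  have whole: "H1 = H \<Longrightarrow> critical_index \<le> final_index G H1"
    unfolding k0 critical_index_def using card_pos[OF subH] by (intro initial_index_mono) auto
  have le: "critical_index \<le> initial_index (order G)"
    unfolding critical_index_def
    using card_pos[OF subH] card_mono[OF fin subgroup.subset[OF subH]]
    by (intro initial_index_mono) (auto simp: order_def)
  obtain r q where rq: "find_new_collision G c H1 f = (r, q)"
    and q: "real q \<le> 9 * A * (scale (critical_index - 1) - scale (initial_index (order G)))"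
    and r: "\<forall>z y. r = Collision z y \<longrightarrow> inv z \<otimes> y \<in> H - H1" "H1 \<noteq> H \<longrightarrow> r \<noteq> No_New_Collision"
    using search_loop_correct[OF H1, of "initial_index (order G)" "final_index G H1"] le proper whole
    unfolding find_new_collision_def by auto
  have "9 * A * (scale (critical_index - 1) - scale (initial_index (order G))) \<le>
      9 * A * (2 * sqrt (order G / card H))"
    using scale_critical_le scale_nonneg[of "initial_index (order G)"] A_nonneg
    by (intro mult_left_mono) auto
  then have "real q \<le> 18 * A * sqrt (order G / card H)"
    using q by linarith
  then show thesis
    using that rq r by blast
qed

text \<open>The factor \<open>1 + log 2 (card H / card (generate G S))\<close> bounds the number of
  searches still to come: every collision at least doubles the generated subgroup, and the 1 pays
  for the last, unsuccessful search. Keeping the identity out of \<open>S\<close> makes an empty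
  \<open>S\<close> at the end equivalent to a trivial \<open>H\<close>.\<close>

lemma find_subgroup_loop_correct:
  assumes "S \<subseteq> H - {\<one>}"
  shows "\<exists>out q'. find_subgroup_loop G c f S q = Some (out, q') \<and>
    (if H = {\<one>} then out = Injective
     else \<exists>T. out = Generators T \<and> T \<subseteq> carrier G \<and> generate G T = H) \<and>
    real q' \<le> q + (1 + log 2 (card H / card (generate G S))) * (18 * A * sqrt (order G / card H))"
  using assms
proof (induction "card H - card (generate G S)" arbitrary: S q rule: less_induct)
  case less
  let ?Q = "18 * A * sqrt (order G / card H)"
  let ?H1 = "generate G S"
  have Q0: "0 \<le> ?Q"
    using A_nonneg by simp
  have SH: "S \<subseteq> H" and Sc: "S \<subseteq> carrier G"
    using less.prems subgroup.subset[OF subH] by auto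
  have H1: "subgroup ?H1 G" "?H1 \<subseteq> H"
    using generate_is_subgroup[OF Sc] generate_subgroup_incl[OF SH subH] .
  obtain r q1 where find: "find_new_collision G c ?H1 f = (r, q1)" and q1: "real q1 \<le> ?Q"
    and coll: "\<And>z y. r = Collision z y \<Longrightarrow> inv z \<otimes> y \<in> H - ?H1"
    and none: "?H1 \<noteq> H \<Longrightarrow> r \<noteq> No_New_Collision"
    using find_new_collision_correct[OF H1] by metis
  show ?case
  proof (cases r)
    case No_New_Collision
    then have eq: "?H1 = H"
      using none by blast
    have loop: "find_subgroup_loop G c f S q =
        Some (if S = {} then Injective else Generators S, q + q1)"
      using find No_New_Collision by (simp add: find_subgroup_loop.simps[of G c f S q])
    have "S = {} \<longleftrightarrow> H = {\<one>}"
      using less.prems eq generate_empty by auto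
    moreover have "real (q + q1) \<le> q + (1 + log 2 (card H / card ?H1)) * ?Q"
      using q1 card_pos[OF subH] by (simp add: eq)
    ultimately show ?thesis
      using loop Sc eq by auto
  next
    case (Collision a b)
    define x where "x = inv a \<otimes> b"
    have x: "x \<in> H" "x \<notin> ?H1"
      using coll[OF Collision] by (auto simp: x_def)
    let ?S' = "S \<union> {x}"
    let ?H2 = "generate G ?S'"
    have loop: "find_subgroup_loop G c f S q = find_subgroup_loop G c f ?S' (q + q1)"
      using find Collision by (simp add: find_subgroup_loop.simps[of G c f S q] x_def)
    have S': "?S' \<subseteq> H - {\<one>}"
      \<comment> \<open>The new element lies outside the generated subgroup, so it is not the
        identity.\<close>
      using less.prems x generate.one[of G S] by auto
    then have "?S' \<subseteq> H" and S'c: "?S' \<subseteq> carrier G"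
      using subgroup.subset[OF subH] by auto
    then have H2: "subgroup ?H2 G" "?H2 \<subseteq> H"
      using generate_is_subgroup[OF S'c] generate_subgroup_incl[OF _ subH] by blast+
    have "?H1 \<subseteq> ?H2"
      by (intro mono_generate) auto
    moreover have "x \<in> ?H2"
      by (intro generate.incl) auto
    ultimately have H12: "2 * card ?H1 \<le> card ?H2"
      using x by (intro card_le_half H1 H2) auto
    have pos: "0 < card ?H1" "0 < card ?H2" "0 < card H"
      using H1 H2 subH card_pos by auto
    have "card ?H2 \<le> card H"
      using H2 finite_subgroup[OF subH] by (intro card_mono)
    then have "card H - card ?H2 < card H - card ?H1"
      using H12 pos by linarith
    from less.hyps[OF this S', of "q + q1"] obtain out q' where
      rest: "find_subgroup_loop G c f ?S' (q + q1) = Some (out, q')"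
      "if H = {\<one>} then out = Injective
       else \<exists>T. out = Generators T \<and> T \<subseteq> carrier G \<and> generate G T = H"
      "real q' \<le> real (q + q1) + (1 + log 2 (card H / card ?H2)) * ?Q"
      by blast
    have "log 2 (2 * card ?H1) \<le> log 2 (card ?H2)"
    proof (rule log_mono)
      show "real (2 * card ?H1) \<le> card ?H2"
        using H12 by (simp only: of_nat_le_iff)
    qed (use pos in auto)
    \<comment> \<open>Doubling lowers the logarithm by at least 1, which pays for the search just
      made.\<close>
    then have "1 + log 2 (card H / card ?H2) \<le> log 2 (card H / card ?H1)"
      using pos by (simp add: log_divide log_mult)
    then have "(1 + log 2 (card H / card ?H2)) * ?Q \<le> log 2 (card H / card ?H1) * ?Q"
      using Q0 by (rule mult_right_mono)
    then have "real q' \<le> q + (1 + log 2 (card H / card ?H1)) * ?Q"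
      using rest(3) q1 by (simp add: distrib_right)
    then show ?thesis
      using loop rest by auto
  qed
qed

lemma find_subgroup_correct:
  "\<exists>out q. find_subgroup G c f = Some (out, q) \<and>
    (if H = {\<one>} then out = Injective
     else \<exists>T. out = Generators T \<and> T \<subseteq> carrier G \<and> generate G T = H) \<and>
    real q \<le> (1 + log 2 (card H)) * (18 * A * sqrt (order G / card H))"
  using find_subgroup_loop_correct[of "{}" 0] generate_empty
  unfolding find_subgroup_def by simp

end

section \<open>Constants for the abelian and the non-abelian bound\<close>

theorem theorem14:
  shows "\<exists>C > 0. \<forall>(G :: ('a, 'b) monoid_scheme) (S :: 's set) (f :: 'a \<Rightarrow> 's) H (c :: ('a, 's) choices).
    group G \<longrightarrow> finite (carrier G) \<longrightarrow> order G > 1 \<longrightarrow>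
    f \<in> carrier G \<rightarrow> S \<longrightarrow> carrier G \<lesssim> S \<longrightarrow>
    subgroup H G \<longrightarrow> hides G f H \<longrightarrow>
    (\<exists>G0. subgroup G0 G \<and> real (card G0) = real (order G) / real (card H) \<and> card (G0 \<inter> H) = 1) \<longrightarrow>
    valid_choices G c \<longrightarrow>
    (\<exists>out q. find_subgroup G c f = Some (out, q) \<and>
       (if H = {\<one>\<^bsub>G\<^esub>} then out = Injective
        else \<exists>T. out = Generators T \<and> T \<subseteq> carrier G \<and> generate G T = H) \<and>
       (let n = real (order G); m = real (card H) in
          (comm_group G \<longrightarrow>
             real q \<le> C * max 1 ((1 + log 2 m) * sqrt (n / m))) \<and>
          (\<not> comm_group G \<longrightarrow>
             real q \<le> C * max 1 ((1 + log 2 m) * sqrt (n / m * index_log (n / m))))))"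
proof (intro exI[of _ "72::real"] conjI allI impI)
  fix G :: "('a, 'b) monoid_scheme" and S :: "'s set" and f :: "'a \<Rightarrow> 's" and H
    and c :: "('a, 's) choices"
  assume G: "group G" and fin: "finite (carrier G)" and subH: "subgroup H G"
    and hides: "hides G f H" and valid: "valid_choices G c"
    and "\<exists>G0. subgroup G0 G \<and> real (card G0) = real (order G) / real (card H) \<and> card (G0 \<inter> H) = 1"
  then obtain G0 where subG0: "subgroup G0 G" and c0: "real (card G0) = order G / card H"
    and i0: "card (G0 \<inter> H) = 1"
    by blast
  interpret group G by (rule G)
  have m0: "card H > 0"
    using subgroup.finite_imp_card_positive[OF subH fin] .
  have "real (card G0 * card H) = real (order G)"
    using c0 m0 by simp
  then have card_G0: "card G0 * card H = order G"
    by (simp only: of_nat_eq_iff)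
  have G0_H: "G0 \<inter> H = {\<one>\<^bsub>G\<^esub>}"
    using card_1_singletonE[OF i0] subgroup.one_closed[OF subG0] subgroup.one_closed[OF subH]
    by (metis IntI singletonD)
  define x where "x = real (order G) / real (card H)"
  define l where "l = 1 + log 2 (card H)"
  have l0: "0 \<le> l"
    using m0 by (simp add: l_def)
  have x1: "1 \<le> x"
    using subgroup.finite_imp_card_positive[OF subG0 fin] by (simp add: x_def flip: c0)
  have idx1: "1 \<le> index_log x"
    by (simp add: index_log_def)
  have K_le: "real (card K) \<le> 2 * x" if "card K * card H \<le> 2 * order G" for K
  proof -
    have "real (card K * card H) \<le> real (2 * order G)"
      using that by (simp only: of_nat_le_iff)
    then show ?thesis
      using m0 by (simp add: x_def field_simps)
  qed
  \<comment> \<open>The pair lemmas contribute the 2; the inner factor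
    \<open>2 * index_log x\<close> bounds the logarithm of any relevant subgroup order. With the 18
    of the search bound this gives 36 in the abelian case and \<open>36 * sqrt 2\<close> otherwise,
    both at most 72.\<close>
  define B where "B = (if comm_group G then 2 else 2 * sqrt (2 * index_log x))"
  have pair: "\<exists>S1 S2. generating_pair G K (S1, S2) \<and> real (max (card S1) (card S2)) \<le> B * sqrt (card K)"
    if K: "subgroup K G" "card K * card H \<le> 2 * order G" for K
  proof (cases "comm_group G")
    case True
    then show ?thesis
      using comm_group.subgroup_generating_pair_sqrt[OF True fin K(1)] by (simp add: B_def)
  next
    case False
    obtain S1 S2 where S: "generating_pair G K (S1, S2)"
      "real (max (card S1) (card S2)) \<le> 2 * sqrt (card K * max 1 (log 2 (card K)))"
      using subgroup_generating_pair_sqrt_log[OF fin K(1)] by auto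
    have "0 < real (card K)"
      using subgroup.finite_imp_card_positive[OF K(1) fin] by simp
    \<comment> \<open>The order of \<open>K\<close> is at most twice the index \<open>x\<close>; the
      resulting summand 1 is absorbed by \<open>index_log x \<ge> 1\<close>.\<close>
    then have "log 2 (card K) \<le> log 2 (2 * x)"
      using K_le[OF K(2)] by simp
    also have "\<dots> = 1 + log 2 x"
      using x1 by (simp add: log_mult)
    also have "\<dots> \<le> 2 * index_log x"
      using idx1 max.cobounded2[of "log 2 x" 1] unfolding index_log_def by linarith
    finally have "max 1 (log 2 (card K)) \<le> 2 * index_log x"
      using idx1 by simp
    then have "sqrt (card K * max 1 (log 2 (card K))) \<le> sqrt (card K * (2 * index_log x))"
      by (intro real_sqrt_le_mono mult_left_mono) auto
    also have "\<dots> = sqrt (2 * index_log x) * sqrt (card K)"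
      by (simp only: real_sqrt_mult mult_ac)
    finally have "real (max (card S1) (card S2)) \<le> B * sqrt (card K)"
      using S(2) False unfolding B_def by simp
    then show ?thesis
      using S(1) by blast
  qed
  interpret subgroup_search G f H c G0 B
    by (intro subgroup_search.intro subgroup_search_axioms.intro)
      (fact G fin subH hides subG0 card_G0 G0_H valid pair)+
  obtain out q where out: "find_subgroup G c f = Some (out, q)"
    "if H = {\<one>\<^bsub>G\<^esub>} then out = Injective
     else \<exists>T. out = Generators T \<and> T \<subseteq> carrier G \<and> generate G T = H"
    and q: "real q \<le> l * (18 * B * sqrt x)"
    using find_subgroup_correct unfolding l_def x_def by blast
  have comm: "real q \<le> 72 * max 1 (l * sqrt x)" if "comm_group G"
  proof -
    have "real q \<le> 36 * (l * sqrt x)"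
      using q that by (simp add: B_def)
    moreover have "0 \<le> l * sqrt x"
      using l0 x1 by simp
    ultimately show ?thesis
      by linarith
  qed
  have noncomm: "real q \<le> 72 * max 1 (l * sqrt (x * index_log x))" if "\<not> comm_group G"
  proof -
    let ?E = "l * sqrt (x * index_log x)"
    have "sqrt 2 \<le> (2 :: real)"
      by (rule real_le_lsqrt) auto
    moreover have E: "0 \<le> ?E"
      using l0 x1 idx1 by simp
    ultimately have "sqrt 2 * ?E \<le> 2 * ?E"
      by (rule mult_right_mono)
    moreover have "l * (18 * B * sqrt x) = 36 * (sqrt 2 * ?E)"
      using that by (simp add: B_def real_sqrt_mult)
    ultimately show ?thesis
      using q E by linarith
  qed
  show "\<exists>out q. find_subgroup G c f = Some (out, q) \<and>
       (if H = {\<one>\<^bsub>G\<^esub>} then out = Injective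
        else \<exists>T. out = Generators T \<and> T \<subseteq> carrier G \<and> generate G T = H) \<and>
       (let n = real (order G); m = real (card H) in
          (comm_group G \<longrightarrow>
             real q \<le> 72 * max 1 ((1 + log 2 m) * sqrt (n / m))) \<and>
          (\<not> comm_group G \<longrightarrow>
             real q \<le> 72 * max 1 ((1 + log 2 m) * sqrt (n / m * index_log (n / m)))))"
    unfolding Let_def x_def[symmetric] l_def[symmetric] using out comm noncomm by blast
qed simp

end
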